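(* Let $J$ be an $n\times n$ information matrix (a real symmetric positive definite matrix) and let $I_1,\dots,I_B$, $1\le B\le n$, be a partition of $\{1,\dots,n\}$ into $B$ disjoint non-empty subsets. For $i,j\in\{1,\dots,B\}$ let $J_{ij}:=J_{I_iI_j}$ be the block of $J$ with rows indexed by $I_i$ and columns indexed by $I_j$, and let $(J^{-1})_{ij}$ denote the block of $J^{-1}$ with rows $I_i$ and columns $I_j$. Let $\mathcal{G}'=(\mathcal{V}',\mathcal{E}')$ be the graph with $\mathcal{V}'=\{1,\dots,B\}$ and $(j,i)\in\mathcal{E}'$ if and only if $J_{I_iI_j}\neq\mathbf{0}$. Then for all $\alpha,\omega\in\mathcal{V}'$, $$(J^{-1})_{\omega\alpha}=\sum_{p\in\Pi_{\mathcal{G}';\alpha\omega}}(-1)^{\ell(p)}\left[\prod_{j=2}^{\ell(p)+1}\Big\{\big((J_{\mathcal{G}'\setminus\{\alpha,\nu_2,\dots,\nu_{j-1}\}})^{-1}\big)_{\nu_j\nu_j}\,J_{\nu_j\nu_{j-1}}\Big\}\right](J^{-1})_{\alpha\alpha},$$ $$(J^{-1})_{\alpha\alpha}=\left(\sum_{\gamma\in\Gamma_{\mathcal{G}';\alpha}}(-1)^{\ell(\gamma)+1}\,J_{\mu_1\mu_{\ell(\gamma)}}\prod_{j=2}^{\ell(\gamma)}\Big\{\big((J_{\mathcal{G}'\setminus\{\alpha,\mu_2,\dots,\mu_{j-1}\}})^{-1}\big)_{\mu_j\mu_j}\,J_{\mu_j\mu_{j-1}}\Big\}\right)^{-1},$$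 where all products are matrix products ordered right-to-left ($\prod_{i=1}^m a_i=a_m\cdots a_1$), the outer inverse is a matrix inverse, $p=(\nu_1,\dots,\nu_{\ell(p)+1})$ is a simple path of length $\ell(p)$ on $\mathcal{G}'$ with $\nu_1=\alpha$, $\nu_{\ell(p)+1}=\omega$, and $\gamma=(\mu_1,\dots,\mu_{\ell(\gamma)},\mu_1)$ is a simple cycle of length $\ell(\gamma)$ on $\mathcal{G}'$ with $\mu_1=\alpha$.
   Context: $\Pi_{\mathcal{G}';\alpha\omega}$ is the (finite) set of simple paths from $\alpha$ to $\omega$ on $\mathcal{G}'$ and $\Gamma_{\mathcal{G}';\alpha}$ the (finite) set of simple cycles from $\alpha$ to itself on $\mathcal{G}'$. A walk of length $\ell$ is a sequence of $\ell+1$ vertices, consecutive ones being joined by an edge. A simple path is a walk whose vertices are all distinct (the trivial walk $(\alpha)$ of length $0$ is the only simple path from $\alpha$ to itself). A simple cycle from $\alpha$ to itself is a walk of length at least $1$ that starts and ends at $\alpha$ and whose intermediate vertices (from the second to the penultimate) are all distinct and different from $\alpha$. In particular the self-loop $(\alpha,\alpha)$ has length 1 and the backtracks $(\alpha,\beta,\alpha)$, $\beta\neq\alpha$, have length 2; a cycle of length at least 3 and its reversal are different simple cycles. Since $J$ is positive definite, each diagonal block is non-zero, so $\mathcal{G}'$ has a self-loop at each vertex. For $S\subset\mathcal{V}'$, $J_{\mathcal{G}'\setminus S}$ is the principal submatrix of $J$ obtained by deleting all rows and columns whose index lies in $\bigcup_{i\in S}I_i$; $\big((J_{\mathcal{G}'\setminus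 S})^{-1}\big)_{\nu\nu}$ is the diagonal block of its inverse with rows and columns $I_\nu$, $\nu\notin S$. For $j=2$ the set $\{\alpha,\nu_2,\dots,\nu_{j-1}\}$ means $\{\alpha\}$ (likewise for the $\mu$'s). Empty products are identity matrices of the appropriate size. *)

theory Defs
  imports
    "Jordan_Normal_Form.DL_Submatrix"
    "Jordan_Normal_Form.Gauss_Jordan_Elimination"
    "Graph_Theory.Pair_Digraph"
    "Graph_Theory.Vertex_Walk"
    "HOL-Library.Disjoint_Sets"
begin

text \<open>Matrix rows and columns are numbered \<open>0, \<dots>, n - 1\<close>, as in \<open>'a mat\<close>; the blocks of the
  partition are numbered \<open>1, \<dots>, B\<close>. A walk \<open>(\<nu>\<^sub>1, \<dots>, \<nu>\<^sub>\<ell>\<^sub>+\<^sub>1)\<close> is the list of its vertices, so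
  \<open>\<nu>\<^sub>j\<close> is \<open>p ! (j - 1)\<close>.\<close>

definition information_matrix :: "nat \<Rightarrow> real mat \<Rightarrow> bool" where
  "information_matrix n J \<longleftrightarrow>
     J \<in> carrier_mat n n \<and> transpose_mat J = J \<and>
     (\<forall>v \<in> carrier_vec n. v \<noteq> 0\<^sub>v n \<longrightarrow> v \<bullet> (J *\<^sub>v v) > 0)"

definition index_partition :: "nat \<Rightarrow> nat \<Rightarrow> (nat \<Rightarrow> nat set) \<Rightarrow> bool" where
  "index_partition n B I \<longleftrightarrow>
     (\<Union>i\<in>{1..B}. I i) = {..<n} \<and> disjoint_family_on I {1..B} \<and> (\<forall>i\<in>{1..B}. I i \<noteq> {})"

text \<open>Unspecified unless the matrix is invertible.\<close>

definition mat_inv :: "'a :: field mat \<Rightarrow> 'a mat" where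
  "mat_inv A = the (mat_inverse A)"

text \<open>\<open>monoid_mat\<close> is the additive monoid of matrices, written multiplicatively; this is the
  matrix analogue of \<open>finsum_vec\<close>.\<close>

definition finsum_mat ::
  "'a :: monoid_add itself \<Rightarrow> nat \<Rightarrow> nat \<Rightarrow> ('c \<Rightarrow> 'a mat) \<Rightarrow> 'c set \<Rightarrow> 'a mat" where
  "finsum_mat ty nr nc = finprod (monoid_mat ty nr nc)"

text \<open>\<open>prod_right_to_left d a m\<close> is \<open>a m * \<dots> * a 1\<close>, where \<open>d\<close> is the number of columns of \<open>a 1\<close>.\<close>

primrec prod_right_to_left ::
  "nat \<Rightarrow> (nat \<Rightarrow> 'a :: semiring_1 mat) \<Rightarrow> nat \<Rightarrow> 'a mat" where
  "prod_right_to_left d a 0 = 1\<^sub>m d"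
| "prod_right_to_left d a (Suc m) = a (Suc m) * prod_right_to_left d a m"

definition block :: "'a mat \<Rightarrow> (nat \<Rightarrow> nat set) \<Rightarrow> nat \<Rightarrow> nat \<Rightarrow> 'a mat" where
  "block A I i j = submatrix A (I i) (I j)"

definition block_graph :: "nat \<Rightarrow> real mat \<Rightarrow> (nat \<Rightarrow> nat set) \<Rightarrow> nat pair_pre_digraph" where
  "block_graph B J I =
     \<lparr> pverts = {1..B},
       parcs = {(j, i). i \<in> {1..B} \<and> j \<in> {1..B} \<and>
                        block J I i j \<noteq> 0\<^sub>m (card (I i)) (card (I j))} \<rparr>"

definition remaining_indices :: "nat \<Rightarrow> (nat \<Rightarrow> nat set) \<Rightarrow> nat set \<Rightarrow> nat set" where
  "remaining_indices n I S = {..<n} - (\<Union>i\<in>S. I i)"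

definition delete_blocks :: "real mat \<Rightarrow> (nat \<Rightarrow> nat set) \<Rightarrow> nat set \<Rightarrow> real mat" where
  "delete_blocks J I S =
     (let R = remaining_indices (dim_row J) I S in submatrix J R R)"

text \<open>In \<open>delete_blocks J I S\<close> the surviving row (or column) \<open>i\<close> of \<open>J\<close> has the number
  \<open>card {a \<in> R. a < i}\<close>, where \<open>R\<close> is the set of surviving indices.\<close>

definition deleted_inv_block :: "real mat \<Rightarrow> (nat \<Rightarrow> nat set) \<Rightarrow> nat set \<Rightarrow> nat \<Rightarrow> real mat" where
  "deleted_inv_block J I S \<nu> =
     (let R = remaining_indices (dim_row J) I S;
          K = (\<lambda>i. card {a \<in> R. a < i}) ` I \<nu>
      in submatrix (mat_inv (delete_blocks J I S)) K K)"

definition simple_paths :: "'a pair_pre_digraph \<Rightarrow> 'a \<Rightarrow> 'a \<Rightarrow> 'a vwalk set" where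
  "simple_paths G \<alpha> \<omega> = {p. vpath p (with_proj G) \<and> hd p = \<alpha> \<and> last p = \<omega>}"

definition simple_cycles :: "'a pair_pre_digraph \<Rightarrow> 'a \<Rightarrow> 'a vwalk set" where
  "simple_cycles G \<alpha> =
     {c. vwalk c (with_proj G) \<and> vwalk_length c \<ge> 1 \<and> hd c = \<alpha> \<and> last c = \<alpha> \<and>
         distinct (tl (butlast c)) \<and> \<alpha> \<notin> set (tl (butlast c))}"

text \<open>For a walk \<open>p\<close> starting at \<open>\<alpha>\<close>, the factor with (1-based) index \<open>j + 1\<close>: the deleted
  vertices \<open>\<alpha>, \<nu>\<^sub>2, \<dots>, \<nu>\<^sub>j\<close> are the first \<open>j\<close> entries of \<open>p\<close>.\<close>

definition walk_factor :: "real mat \<Rightarrow> (nat \<Rightarrow> nat set) \<Rightarrow> nat vwalk \<Rightarrow> nat \<Rightarrow> real mat" where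
  "walk_factor J I p j =
     deleted_inv_block J I (set (take j p)) (p ! j) * block J I (p ! j) (p ! (j - 1))"

definition path_term :: "real mat \<Rightarrow> (nat \<Rightarrow> nat set) \<Rightarrow> nat vwalk \<Rightarrow> real mat" where
  "path_term J I p =
     (-1) ^ vwalk_length p \<cdot>\<^sub>m
       (prod_right_to_left (card (I (hd p))) (walk_factor J I p) (vwalk_length p)
         * block (mat_inv J) I (hd p) (hd p))"

definition cycle_term :: "real mat \<Rightarrow> (nat \<Rightarrow> nat set) \<Rightarrow> nat vwalk \<Rightarrow> real mat" where
  "cycle_term J I c =
     (-1) ^ (vwalk_length c + 1) \<cdot>\<^sub>m
       (block J I (hd c) (c ! (vwalk_length c - 1))
         * prod_right_to_left (card (I (hd c))) (walk_factor J I c) (vwalk_length c - 1))"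

end

theory Submission
  imports Defs "Jordan_Normal_Form.Determinant"
begin

text \<open>Write \<open>N S\<close> for the inverse of the matrix left after deleting the blocks in \<open>S\<close>, and let \<open>R\<close>
  be the set of indices outside \<open>S \<union> {\<alpha>}\<close>. The rows \<open>R\<close> of the block column \<open>\<alpha>\<close> of \<open>J * N S = 1\<close> give
  \<open>N S [R, \<alpha>] = - N (S \<union> {\<alpha>}) * J [R, \<alpha>] * N S [\<alpha>, \<alpha>]\<close>. Applying this repeatedly deletes the
  vertices of a list of distinct vertices one after the other, and yields the sum over simple paths;
  lists that leave the graph contribute zero. The rows \<open>\<alpha>\<close> of \<open>J * N {} = 1\<close> then say that the Schur
  complement \<open>J [\<alpha>, \<alpha>] - J [\<alpha>, R] * N {\<alpha>} * J [R, \<alpha>]\<close> is the inverse of \<open>N {} [\<alpha>, \<alpha>]\<close>, and the path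
  expansion of \<open>N {\<alpha>}\<close> turns this complement into the sum over simple cycles.\<close>

section \<open>Matrices indexed by finite sets of natural numbers\<close>

text \<open>Entries are addressed by the original indices of the big matrix, so that products of
  blocks become sums over index sets and deletions need no renumbering.\<close>

definition set_mat :: "nat set \<Rightarrow> nat set \<Rightarrow> (nat \<Rightarrow> nat \<Rightarrow> 'a) \<Rightarrow> 'a mat" where
  "set_mat X Y f = mat (card X) (card Y) (\<lambda>(i, j). f (pick X i) (pick Y j))"

text \<open>The inverse of \<open>pick R\<close> on \<open>R\<close>, and the renumbering of
  surviving rows used in \<open>deleted_inv_block\<close>.\<close>

definition rank_in :: "nat set \<Rightarrow> nat \<Rightarrow> nat" where
  "rank_in R i = card {a \<in> R. a < i}"

lemma pick_rank_in: "i \<in> R \<Longrightarrow> pick R (rank_in R i) = i"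
  unfolding rank_in_def by (rule pick_card_in_set)

lemma rank_in_pick: "k < card R \<Longrightarrow> rank_in R (pick R k) = k"
  unfolding rank_in_def by (simp add: card_pick)

lemma rank_in_less: "finite R \<Longrightarrow> i \<in> R \<Longrightarrow> rank_in R i < card R"
  unfolding rank_in_def by (rule psubset_card_mono) auto

lemma rank_in_strict_mono: "finite R \<Longrightarrow> i \<in> R \<Longrightarrow> i < j \<Longrightarrow> rank_in R i < rank_in R j"
  unfolding rank_in_def by (rule psubset_card_mono) auto

lemma rank_in_less_iff:
  assumes "finite R" "i \<in> R" "j \<in> R"
  shows "rank_in R i < rank_in R j \<longleftrightarrow> i < j"
  by (metis assms linorder_neqE_nat not_less_iff_gr_or_eq rank_in_strict_mono)

lemma inj_on_rank_in: "inj_on (rank_in R) R"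
  by (rule inj_on_inverseI[of _ "pick R"]) (rule pick_rank_in)

lemma bij_betw_pick: "finite X \<Longrightarrow> bij_betw (pick X) {..<card X} X"
  by (rule bij_betw_byWitness[where f' = "rank_in X"])
    (auto simp: rank_in_pick pick_rank_in rank_in_less pick_in_set)

text \<open>The renumbering is strictly increasing on \<open>R\<close>: as many elements of the
  image lie below \<open>rank_in R x\<close> as elements of \<open>X\<close> lie below
  \<open>x\<close>.\<close>

lemma pick_image_rank_in:
  assumes R: "finite R" and X: "X \<subseteq> R" and k: "k < card X"
  shows "pick (rank_in R ` X) k = rank_in R (pick X k)"
proof -
  let ?x = "pick X k"
  have x: "?x \<in> X" using k by (simp add: pick_in_set)
  have "{a \<in> rank_in R ` X. a < rank_in R ?x} = rank_in R ` {a \<in> X. a < ?x}"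
    using rank_in_less_iff[OF R] X x by blast
  moreover have "inj_on (rank_in R) {a \<in> X. a < ?x}"
    by (rule inj_on_subset[OF inj_on_rank_in]) (use X in auto)
  ultimately have "rank_in (rank_in R ` X) (rank_in R ?x) = rank_in X ?x"
    unfolding rank_in_def[of "rank_in R ` X"] rank_in_def[of X] by (simp add: card_image)
  then show ?thesis
    using pick_rank_in[of "rank_in R ?x" "rank_in R ` X"] x k by (simp add: rank_in_pick)
qed

lemma set_mat_carrier [simp]: "set_mat X Y f \<in> carrier_mat (card X) (card Y)"
  and dim_row_set_mat [simp]: "dim_row (set_mat X Y f) = card X"
  and dim_col_set_mat [simp]: "dim_col (set_mat X Y f) = card Y"
  by (simp_all add: set_mat_def)

lemma set_mat_cong:
  "(\<And>i j. i \<in> X \<Longrightarrow> j \<in> Y \<Longrightarrow> f i j = g i j) \<Longrightarrow> set_mat X Y f = set_mat X Y g"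
  by (intro eq_matI) (auto simp: set_mat_def pick_in_set)

text \<open>Every index of a finite set has a position in the matrix, so matrix identities can be
  read off as identities between entries.\<close>

lemma set_mat_eqD:
  assumes eq: "set_mat X Y f = set_mat X Y g" and fin: "finite X" "finite Y"
    and ij: "i \<in> X" "j \<in> Y"
  shows "f i j = g i j"
proof -
  have "set_mat X Y f $$ (rank_in X i, rank_in Y j) = set_mat X Y g $$ (rank_in X i, rank_in Y j)"
    using eq by simp
  then show ?thesis
    using fin ij by (simp add: set_mat_def rank_in_less pick_rank_in)
qed

lemma set_mat_mult:
  assumes "finite K"
  shows "set_mat X K f * set_mat K Y g = set_mat X Y (\<lambda>i j. \<Sum>k\<in>K. f i k * g k j)"
    (is "?L = ?R")
proof (rule eq_matI)
  fix i j assume "i < dim_row ?R" "j < dim_col ?R"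
  then have ij: "i < card X" "j < card Y" by simp_all
  have "?L $$ (i, j) = (\<Sum>k<card K. f (pick X i) (pick K k) * g (pick K k) (pick Y j))"
    using ij by (simp add: set_mat_def scalar_prod_def atLeast0LessThan)
  also have "\<dots> = (\<Sum>k\<in>K. f (pick X i) k * g k (pick Y j))"
    by (rule sum.reindex_bij_betw[OF bij_betw_pick[OF assms]])
  finally show "?L $$ (i, j) = ?R $$ (i, j)" using ij by (simp add: set_mat_def)
qed simp_all

lemma set_mat_one: "set_mat X X (\<lambda>i j. of_bool (i = j)) = 1\<^sub>m (card X)"
proof (rule eq_matI)
  fix i j assume "i < dim_row (1\<^sub>m (card X) :: 'a mat)" "j < dim_col (1\<^sub>m (card X) :: 'a mat)"
  then have ij: "i < card X" "j < card X" by simp_all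
  then have "pick X i = pick X j \<longleftrightarrow> i = j" by (metis rank_in_pick)
  then show "set_mat X X (\<lambda>i j. of_bool (i = j)) $$ (i, j) = (1\<^sub>m (card X) :: 'a mat) $$ (i, j)"
    using ij by (simp add: set_mat_def)
qed simp_all

lemma set_mat_smult: "c \<cdot>\<^sub>m set_mat X Y f = set_mat X Y (\<lambda>i j. c * f i j)"
  by (rule eq_matI) (simp_all add: set_mat_def)

lemma set_mat_zero: "set_mat X Y (\<lambda>i j. 0) = 0\<^sub>m (card X) (card Y)"
  by (rule eq_matI) (simp_all add: set_mat_def)

lemma submatrix_eq_set_mat:
  assumes "A \<in> carrier_mat m m'" "X \<subseteq> {..<m}" "Y \<subseteq> {..<m'}"
  shows "submatrix A X Y = set_mat X Y (\<lambda>i j. A $$ (i, j))"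
proof -
  have "{i. i < m \<and> i \<in> X} = X" "{j. j < m' \<and> j \<in> Y} = Y" using assms by auto
  then show ?thesis using assms(1) by (simp add: submatrix_def set_mat_def)
qed

lemma mat_eq_set_mat:
  assumes "A \<in> carrier_mat (card X) (card Y)"
  shows "A = set_mat X Y (\<lambda>i j. A $$ (rank_in X i, rank_in Y j))"
  by (rule eq_matI) (use assms in \<open>auto simp: set_mat_def rank_in_pick\<close>)

text \<open>Translates a diagonal block of a matrix on the survivors \<open>R\<close>, cut out by
  renumbered positions as in \<open>deleted_inv_block\<close>, back to original indices.\<close>

lemma submatrix_rank_in:
  assumes A: "A \<in> carrier_mat (card R) (card R)" and R: "finite R" and X: "X \<subseteq> R"
  shows "submatrix A (rank_in R ` X) (rank_in R ` X) =
    set_mat X X (\<lambda>i j. A $$ (rank_in R i, rank_in R j))"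
proof -
  have sub: "rank_in R ` X \<subseteq> {..<card R}" using R X rank_in_less by auto
  have card: "card (rank_in R ` X) = card X"
    by (rule card_image) (rule inj_on_subset[OF inj_on_rank_in X])
  show ?thesis
    unfolding submatrix_eq_set_mat[OF A sub sub]
    by (rule eq_matI) (auto simp: set_mat_def card pick_image_rank_in[OF R X])
qed

lemma finsum_mat_set_mat:
  fixes f :: "'c \<Rightarrow> nat \<Rightarrow> nat \<Rightarrow> 'a :: comm_monoid_add"
  assumes "finite A" and "\<And>x. x \<in> A \<Longrightarrow> F x = set_mat X Y (f x)"
  shows "finsum_mat TYPE('a) (card X) (card Y) F A = set_mat X Y (\<lambda>i j. \<Sum>x\<in>A. f x i j)"
proof -
  interpret comm_monoid "monoid_mat TYPE('a) (card X) (card Y)" by (rule comm_monoid_mat)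
  show ?thesis
    using assms
  proof (induction A rule: finite_induct)
    case empty
    \<comment> \<open>The unit of the multiplicatively written \<open>monoid_mat\<close> is the zero
      matrix.\<close>
    have "finsum_mat TYPE('a) (card X) (card Y) F {} = 0\<^sub>m (card X) (card Y)"
      unfolding finsum_mat_def finprod_empty by (simp add: monoid_mat_def)
    then show ?case by (simp add: set_mat_zero)
  next
    case (insert x A)
    have F: "F \<in> A \<rightarrow> carrier (monoid_mat TYPE('a) (card X) (card Y))"
      "F x \<in> carrier (monoid_mat TYPE('a) (card X) (card Y))"
      using insert.prems by (auto simp: monoid_mat_def)
    have "finsum_mat TYPE('a) (card X) (card Y) F (insert x A) =
        F x + finsum_mat TYPE('a) (card X) (card Y) F A"
      unfolding finsum_mat_def using finprod_insert[OF insert.hyps F] by (simp add: monoid_mat_def)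
    also have "\<dots> = set_mat X Y (f x) + set_mat X Y (\<lambda>i j. \<Sum>x\<in>A. f x i j)"
      using insert.IH insert.prems by simp
    also have "\<dots> = set_mat X Y (\<lambda>i j. \<Sum>x\<in>insert x A. f x i j)"
      by (rule eq_matI) (use insert.hyps in \<open>auto simp: set_mat_def\<close>)
    finally show ?case .
  qed
qed

section \<open>Inverses\<close>

text \<open>For square matrices over a field a right inverse is two-sided. Hence
  \<open>mat_inverse\<close> succeeds, and uniqueness of inverses identifies its value.\<close>

lemma mat_inv_eq:
  fixes A :: "'a :: field mat"
  assumes A: "A \<in> carrier_mat m m" and X: "X \<in> carrier_mat m m" and AX: "A * X = 1\<^sub>m m"
  shows "invertible_mat A" and "mat_inv A = X"
proof -
  have XA: "X * A = 1\<^sub>m m" by (rule mat_mult_left_right_inverse[OF A X AX])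
  show "invertible_mat A"
    unfolding invertible_mat_def inverts_mat_def using A X AX XA by auto
  have "A \<in> Units (ring_mat TYPE('a) m ())"
    unfolding Units_def ring_mat_def using A X AX XA by auto
  then obtain Y where Y: "mat_inverse A = Some Y" using mat_inverse(1)[OF A] by fastforce
  then have Y': "Y \<in> carrier_mat m m" "Y * A = 1\<^sub>m m" using mat_inverse(2)[OF A] by auto
  have "Y = Y * (A * X)" using Y' AX by simp
  also have "\<dots> = Y * A * X" by (rule assoc_mult_mat[symmetric, OF Y'(1) A X])
  also have "\<dots> = X" using Y' X by simp
  finally show "mat_inv A = X" using Y by (simp add: mat_inv_def)
qed

lemma mat_inv_works:
  fixes A :: "'a :: field mat"
  assumes A: "A \<in> carrier_mat m m" and "det A \<noteq> 0"
  shows "mat_inv A \<in> carrier_mat m m" "A * mat_inv A = 1\<^sub>m m" "mat_inv A * A = 1\<^sub>m m"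
proof -
  obtain Y where "mat_inverse A = Some Y"
    using mat_inverse(1)[OF A] det_non_zero_imp_unit[OF assms] by fastforce
  then show "mat_inv A \<in> carrier_mat m m" "A * mat_inv A = 1\<^sub>m m" "mat_inv A * A = 1\<^sub>m m"
    using mat_inverse(2)[OF A] by (auto simp: mat_inv_def)
qed

text \<open>A kernel vector \<open>v\<close> of the submatrix, extended by zero to \<open>w\<close>,
  would violate positive definiteness: \<open>w\<close> vanishes off \<open>R\<close> and
  \<open>J *\<^sub>v w\<close> vanishes on \<open>R\<close>.\<close>

lemma det_principal_submatrix_nonzero:
  assumes J: "information_matrix n J" and R: "R \<subseteq> {..<n}"
  shows "det (submatrix J R R) \<noteq> 0"
proof
  assume det: "det (submatrix J R R) = 0"
  have Jc: "J \<in> carrier_mat n n" using J by (simp add: information_matrix_def)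
  have fin: "finite R" using R finite_subset by blast
  define M where "M = submatrix J R R"
  have M: "M = set_mat R R (\<lambda>i j. J $$ (i, j))"
    unfolding M_def by (rule submatrix_eq_set_mat[OF Jc R R])
  then have Mc: "M \<in> carrier_mat (card R) (card R)" by simp
  obtain v where v: "v \<in> carrier_vec (card R)" "v \<noteq> 0\<^sub>v (card R)" "M *\<^sub>v v = 0\<^sub>v (card R)"
    using det det_0_iff_vec_prod_zero[OF Mc] unfolding M_def by auto
  define w where "w = vec n (\<lambda>i. if i \<in> R then v $ rank_in R i else 0)"
  have w: "w \<in> carrier_vec n" by (simp add: w_def)
  have w_pick: "w $ pick R k = v $ k" if "k < card R" for k
    using that R pick_in_set[of k R] by (auto simp: w_def rank_in_pick)
  have w0: "w \<noteq> 0\<^sub>v n"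
  proof
    assume "w = 0\<^sub>v n"
    then have "v $ k = 0" if "k < card R" for k
      using w_pick[OF that] R pick_in_set[of k R] that by auto
    then show False using v by (metis carrier_vecD eq_vecI index_zero_vec)
  qed
  have Jw: "(J *\<^sub>v w) $ i = 0" if "i \<in> R" for i
  proof -
    have "i < n" using that R by auto
    then have "(J *\<^sub>v w) $ i = (\<Sum>k<n. J $$ (i, k) * w $ k)"
      using Jc w by (simp add: scalar_prod_def atLeast0LessThan)
    also have "\<dots> = (\<Sum>k\<in>R. J $$ (i, k) * w $ k)"
      by (rule sum.mono_neutral_right) (use R in \<open>auto simp: w_def\<close>)
    also have "\<dots> = (\<Sum>k<card R. J $$ (i, pick R k) * w $ pick R k)"
      by (rule sum.reindex_bij_betw[OF bij_betw_pick[OF fin], symmetric])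
    also have "\<dots> = (M *\<^sub>v v) $ rank_in R i"
      using v(1) that fin
      by (simp add: M set_mat_def scalar_prod_def atLeast0LessThan rank_in_less pick_rank_in w_pick)
    also have "\<dots> = 0" using v(3) that fin by (simp add: rank_in_less)
    finally show ?thesis .
  qed
  have "w \<bullet> (J *\<^sub>v w) = (\<Sum>i<n. w $ i * (J *\<^sub>v w) $ i)"
    using Jc by (simp add: scalar_prod_def atLeast0LessThan)
  also have "\<dots> = 0"
    by (rule sum.neutral) (use Jw in \<open>auto simp: w_def\<close>)
  finally show False using J w w0 by (auto simp: information_matrix_def)
qed

text \<open>The inverse of the principal submatrix on \<open>R\<close>, with the row and column numbers of \<open>J\<close>.\<close>

definition inv_on :: "real mat \<Rightarrow> nat set \<Rightarrow> nat \<Rightarrow> nat \<Rightarrow> real" where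
  "inv_on J R i j = mat_inv (submatrix J R R) $$ (rank_in R i, rank_in R j)"

lemma inv_on_inverse:
  assumes J: "information_matrix n J" and R: "R \<subseteq> {..<n}" and ij: "i \<in> R" "j \<in> R"
  shows "(\<Sum>k\<in>R. J $$ (i, k) * inv_on J R k j) = of_bool (i = j)"
    and "(\<Sum>k\<in>R. inv_on J R i k * J $$ (k, j)) = of_bool (i = j)"
proof -
  have fin: "finite R" using R finite_subset by blast
  define M where "M = submatrix J R R"
  have M: "M = set_mat R R (\<lambda>i j. J $$ (i, j))"
    unfolding M_def by (rule submatrix_eq_set_mat[OF _ R R])
      (use J in \<open>simp add: information_matrix_def\<close>)
  then have Mc: "M \<in> carrier_mat (card R) (card R)" by simp
  have "det M \<noteq> 0" unfolding M_def by (rule det_principal_submatrix_nonzero[OF J R])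
  note inv = mat_inv_works[OF Mc this]
  have N: "mat_inv M = set_mat R R (inv_on J R)"
    using mat_eq_set_mat[OF inv(1)] by (simp add: inv_on_def[abs_def] M_def)
  show "(\<Sum>k\<in>R. J $$ (i, k) * inv_on J R k j) = of_bool (i = j)"
    by (rule set_mat_eqD[OF _ fin fin ij])
      (use inv(2)[unfolded N, unfolded M] in \<open>simp add: set_mat_mult[OF fin] set_mat_one\<close>)
  show "(\<Sum>k\<in>R. inv_on J R i k * J $$ (k, j)) = of_bool (i = j)"
    by (rule set_mat_eqD[OF _ fin fin ij])
      (use inv(3)[unfolded N, unfolded M] in \<open>simp add: set_mat_mult[OF fin] set_mat_one\<close>)
qed

text \<open>The equation \<open>J * N = 1\<close> on \<open>R\<close>, in rows outside
  \<open>X\<close> and columns in \<open>X\<close>, is solved for those rows of \<open>N\<close> by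
  multiplying from the left with the inverse on \<open>R - X\<close>.\<close>

lemma inv_on_block_elimination:
  assumes J: "information_matrix n J" and R: "R \<subseteq> {..<n}" and X: "X \<subseteq> R"
    and i: "i \<in> R - X" and j: "j \<in> X"
  shows "inv_on J R i j =
    - (\<Sum>l\<in>R - X. \<Sum>k\<in>X. inv_on J (R - X) i l * J $$ (l, k) * inv_on J R k j)"
proof -
  let ?N = "inv_on J R" and ?N' = "inv_on J (R - X)"
  have fin: "finite R" using R finite_subset by blast
  have split: "(\<Sum>k\<in>R - X. J $$ (l, k) * ?N k j) = - (\<Sum>k\<in>X. J $$ (l, k) * ?N k j)"
    if l: "l \<in> R - X" for l
  proof -
    \<comment> \<open>An off-diagonal entry of the identity, since \<open>l\<close> lies outside
      \<open>X\<close> and \<open>j\<close> inside.\<close>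
    have "(\<Sum>k\<in>R. J $$ (l, k) * ?N k j) = 0"
      using inv_on_inverse(1)[OF J R, of l j] l j X by auto
    then show ?thesis by (simp add: sum.subset_diff[OF X fin])
  qed
  have "?N i j = (\<Sum>k\<in>R - X. of_bool (i = k) * ?N k j)"
    using i fin by (simp add: of_bool_def if_distrib[of "\<lambda>x. x * _"] cong: if_cong)
  \<comment> \<open>The identity on \<open>R - X\<close> is written as \<open>?N'\<close> times the
    corresponding submatrix of \<open>J\<close>.\<close>
  also have "\<dots> = (\<Sum>k\<in>R - X. (\<Sum>l\<in>R - X. ?N' i l * J $$ (l, k)) * ?N k j)"
  proof (rule sum.cong[OF refl])
    fix k assume "k \<in> R - X"
    moreover have "R - X \<subseteq> {..<n}" using R by auto
    ultimately show "of_bool (i = k) * ?N k j = (\<Sum>l\<in>R - X. ?N' i l * J $$ (l, k)) * ?N k j"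
      using inv_on_inverse(2)[OF J _ i] by simp
  qed
  also have "\<dots> = (\<Sum>l\<in>R - X. ?N' i l * (\<Sum>k\<in>R - X. J $$ (l, k) * ?N k j))"
    unfolding sum_distrib_left sum_distrib_right
    by (subst sum.swap) (simp add: mult.assoc)
  also have "\<dots> = (\<Sum>l\<in>R - X. ?N' i l * - (\<Sum>k\<in>X. J $$ (l, k) * ?N k j))"
    by (rule sum.cong) (simp_all add: split)
  also have "\<dots> = - (\<Sum>l\<in>R - X. \<Sum>k\<in>X. ?N' i l * J $$ (l, k) * ?N k j)"
    by (simp add: sum_distrib_left mult.assoc sum_negf)
  finally show ?thesis .
qed

section \<open>Ordered products\<close>

lemma prod_right_to_left_cong:
  "(\<And>j. 1 \<le> j \<Longrightarrow> j \<le> m \<Longrightarrow> a j = b j) \<Longrightarrow> prod_right_to_left d a m = prod_right_to_left d b m"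
  by (induction m) auto

text \<open>The sequence \<open>c\<close> records the dimensions along the chain, so that
  neighbouring factors fit.\<close>

lemma prod_right_to_left_carrier:
  "(\<And>j. 1 \<le> j \<Longrightarrow> j \<le> m \<Longrightarrow> a j \<in> carrier_mat (c j) (c (j - 1))) \<Longrightarrow>
    prod_right_to_left (c 0) a m \<in> carrier_mat (c m) (c 0)"
proof (induction m)
  case (Suc m)
  have "a (Suc m) \<in> carrier_mat (c (Suc m)) (c m)" using Suc.prems[of "Suc m"] by simp
  with Suc show ?case by (auto intro: mult_carrier_mat)
qed simp

text \<open>The defining recursion peels off the leftmost factor; associativity lets the rightmost
  one be peeled off instead, to match recursion on a vertex list from its head.\<close>

lemma prod_right_to_left_shift:
  "(\<And>j. 1 \<le> j \<Longrightarrow> j \<le> Suc m \<Longrightarrow> a j \<in> carrier_mat (c j) (c (j - 1))) \<Longrightarrow>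
    prod_right_to_left (c 0) a (Suc m) =
      prod_right_to_left (c 1) (\<lambda>j. a (Suc j)) m * a 1"
proof (induction m)
  case 0
  then have "a 1 \<in> carrier_mat (c 1) (c 0)" using "0"[of 1] by simp
  then show ?case by simp
next
  case (Suc m)
  have a1: "a 1 \<in> carrier_mat (c 1) (c 0)" using Suc.prems[of 1] by simp
  have am: "a (Suc (Suc m)) \<in> carrier_mat (c (Suc (Suc m))) (c (Suc m))"
    using Suc.prems[of "Suc (Suc m)"] by simp
  have P: "prod_right_to_left (c 1) (\<lambda>j. a (Suc j)) m \<in> carrier_mat (c (Suc m)) (c 1)"
    using prod_right_to_left_carrier[of m "\<lambda>j. a (Suc j)" "\<lambda>j. c (Suc j)"]
      Suc.prems[of "Suc _"] by simp
  have "prod_right_to_left (c 0) a (Suc (Suc m)) =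
      a (Suc (Suc m)) * (prod_right_to_left (c 1) (\<lambda>j. a (Suc j)) m * a 1)"
    using Suc by simp
  then show ?case using assoc_mult_mat[OF am P a1] by simp
qed

section \<open>Expansion over simple paths and simple cycles\<close>

locale partitioned_information_matrix =
  fixes J :: "real mat" and n B :: nat and I :: "nat \<Rightarrow> nat set"
  assumes info: "information_matrix n J" and part: "index_partition n B I"
begin

abbreviation V :: "nat set" where "V \<equiv> {1..B}"

abbreviation rest :: "nat set \<Rightarrow> nat set" where "rest S \<equiv> remaining_indices n I S"

abbreviation N :: "nat set \<Rightarrow> nat \<Rightarrow> nat \<Rightarrow> real" where "N S \<equiv> inv_on J (rest S)"

abbreviation blk :: "nat \<Rightarrow> nat \<Rightarrow> real mat" where
  "blk \<beta> \<alpha> \<equiv> set_mat (I \<beta>) (I \<alpha>) (\<lambda>i j. J $$ (i, j))"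

abbreviation diag_inv :: "nat set \<Rightarrow> nat \<Rightarrow> real mat" where
  "diag_inv S \<nu> \<equiv> set_mat (I \<nu>) (I \<nu>) (N S)"

section \<open>Blocks of \<open>J\<close> and of the inverses in original indices\<close>

lemma J_carrier: "J \<in> carrier_mat n n"
  using info by (simp add: information_matrix_def)

lemma I_subset: "\<beta> \<in> V \<Longrightarrow> I \<beta> \<subseteq> {..<n}"
  using part unfolding index_partition_def by blast

lemma finite_I: "\<beta> \<in> V \<Longrightarrow> finite (I \<beta>)"
  using I_subset finite_subset by blast

lemma I_disjoint: "\<beta> \<in> V \<Longrightarrow> \<gamma> \<in> V \<Longrightarrow> \<beta> \<noteq> \<gamma> \<Longrightarrow> I \<beta> \<inter> I \<gamma> = {}"
  using part unfolding index_partition_def disjoint_family_on_def by blast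

lemma rest_subset: "rest S \<subseteq> {..<n}"
  by (auto simp: remaining_indices_def)

lemma finite_rest: "finite (rest S)"
  using rest_subset finite_subset by blast

lemma rest_empty: "rest {} = {..<n}"
  by (simp add: remaining_indices_def)

lemma rest_insert: "rest (insert \<alpha> S) = rest S - I \<alpha>"
  by (auto simp: remaining_indices_def)

lemma I_subset_rest: "S \<subseteq> V \<Longrightarrow> \<beta> \<in> V - S \<Longrightarrow> I \<beta> \<subseteq> rest S"
  using I_subset[of \<beta>] I_disjoint[of \<beta>] unfolding remaining_indices_def by blast

lemma rest_eq_UN: "S \<subseteq> V \<Longrightarrow> rest S = (\<Union>\<beta>\<in>V - S. I \<beta>)"
  using I_subset_rest[of S] part unfolding remaining_indices_def index_partition_def by blast

lemma sum_rest: "S \<subseteq> V \<Longrightarrow> (\<Sum>k\<in>rest S. f k) = (\<Sum>\<beta>\<in>V - S. \<Sum>k\<in>I \<beta>. f k)"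
  unfolding rest_eq_UN
  by (rule sum.UNION_disjoint) (simp, blast intro: finite_I, blast dest: I_disjoint)

lemma block_J: "\<beta> \<in> V \<Longrightarrow> \<alpha> \<in> V \<Longrightarrow> block J I \<beta> \<alpha> = blk \<beta> \<alpha>"
  unfolding block_def by (intro submatrix_eq_set_mat[OF J_carrier] I_subset)

lemma delete_blocks_carrier:
  "delete_blocks J I S \<in> carrier_mat (card (rest S)) (card (rest S))"
  using submatrix_eq_set_mat[OF J_carrier rest_subset rest_subset] J_carrier
  by (simp add: delete_blocks_def Let_def)

lemma mat_inv_delete_blocks_carrier:
  "mat_inv (delete_blocks J I S) \<in> carrier_mat (card (rest S)) (card (rest S))"
  by (rule mat_inv_works(1)[OF delete_blocks_carrier])
    (use J_carrier det_principal_submatrix_nonzero[OF info rest_subset] in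
      \<open>simp add: delete_blocks_def Let_def\<close>)

lemma deleted_inv_block_eq:
  assumes "S \<subseteq> V" "\<nu> \<in> V - S"
  shows "deleted_inv_block J I S \<nu> = diag_inv S \<nu>"
  using submatrix_rank_in[OF mat_inv_delete_blocks_carrier finite_rest I_subset_rest[OF assms]]
    J_carrier
  by (simp add: deleted_inv_block_def Let_def rank_in_def inv_on_def[abs_def] delete_blocks_def)

text \<open>Without deletions the remaining indices are \<open>{..<n}\<close>, on which
  \<open>pick\<close> and \<open>rank_in\<close> are the identity.\<close>

lemma block_mat_inv:
  assumes "\<beta> \<in> V" "\<alpha> \<in> V"
  shows "block (mat_inv J) I \<beta> \<alpha> = set_mat (I \<beta>) (I \<alpha>) (N {})"
proof -
  have del: "submatrix J {..<n} {..<n} = J"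
  proof (rule eq_matI)
    fix i j assume "i < dim_row J" "j < dim_col J"
    then have ij: "i < n" "j < n" using J_carrier by auto
    have "pick {..<n} k = k" if "k < n" for k
      using pick_rank_in[of k "{..<n}"] that
      by (simp add: rank_in_def Collect_conj_eq lessThan_def[symmetric] Int_absorb1)
    then show "submatrix J {..<n} {..<n} $$ (i, j) = J $$ (i, j)"
      using ij submatrix_eq_set_mat[OF J_carrier order_refl order_refl] by (simp add: set_mat_def)
  qed (use submatrix_eq_set_mat[OF J_carrier order_refl order_refl] J_carrier in simp_all)
  have rank: "rank_in {..<n} i = i" if "i < n" for i
  proof -
    have "{a \<in> {..<n}. a < i} = {..<i}" using that by auto
    then show ?thesis by (simp add: rank_in_def)
  qed
  have c: "mat_inv J \<in> carrier_mat n n"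
    using mat_inv_delete_blocks_carrier[of "{}"] J_carrier
    by (simp add: delete_blocks_def rest_empty del)
  show ?thesis
    unfolding block_def submatrix_eq_set_mat[OF c I_subset[OF assms(1)] I_subset[OF assms(2)]]
    by (rule set_mat_cong)
      (use I_subset assms in \<open>auto simp: inv_on_def rest_empty del rank subset_eq\<close>)
qed

section \<open>Path expansion of the entries of the inverse\<close>

text \<open>The entries of the signed term of the vertex list \<open>p\<close> in the expansion of \<open>N S\<close>. It is
  defined for all lists, and vanishes on those that do not follow the edges of the graph.\<close>

fun path_entry :: "nat set \<Rightarrow> nat list \<Rightarrow> nat \<Rightarrow> nat \<Rightarrow> real" where
  "path_entry S [] i j = 0"
| "path_entry S [\<alpha>] i j = N S i j"
| "path_entry S (\<alpha> # \<beta> # ps) i j =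
    - (\<Sum>l\<in>I \<beta>. \<Sum>k\<in>I \<alpha>. path_entry (insert \<alpha> S) (\<beta> # ps) i l * J $$ (l, k) * N S k j)"

text \<open>Simple paths of the complete graph on the vertices outside \<open>S\<close>. Edges can
  be ignored at first, because lists that leave the block graph contribute zero.\<close>

definition distinct_lists :: "nat set \<Rightarrow> nat \<Rightarrow> nat \<Rightarrow> nat list set" where
  "distinct_lists S \<alpha> \<omega> =
    {p. p \<noteq> [] \<and> distinct p \<and> set p \<subseteq> V - S \<and> hd p = \<alpha> \<and> last p = \<omega>}"

lemma finite_distinct_subset: "finite {p. distinct p \<and> set p \<subseteq> V - S}"
  using finite_subset_distinct[of "V - S"] by (simp add: conj_commute)

lemma finite_distinct_lists: "finite (distinct_lists S \<alpha> \<omega>)"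
  by (rule finite_subset[OF _ finite_distinct_subset[of S]]) (auto simp: distinct_lists_def)

lemma distinct_lists_same:
  assumes "\<alpha> \<in> V - S"
  shows "distinct_lists S \<alpha> \<alpha> = {[\<alpha>]}"
proof -
  have "p = [\<alpha>]" if "p \<in> distinct_lists S \<alpha> \<alpha>" for p
  proof (cases p)
    case (Cons a q)
    with that show ?thesis
      by (cases "q = []") (auto simp: distinct_lists_def dest: last_in_set)
  qed (use that in \<open>simp add: distinct_lists_def\<close>)
  then show ?thesis using assms by (auto simp: distinct_lists_def)
qed

text \<open>Classifies the lists by their second vertex \<open>\<beta>\<close>, which exists because
  the end differs from the start.\<close>

lemma distinct_lists_rec:
  assumes "\<alpha> \<in> V - S" "\<alpha> \<noteq> \<omega>"
  shows "distinct_lists S \<alpha> \<omega> = (\<Union>\<beta>\<in>V - insert \<alpha> S. (#) \<alpha> ` distinct_lists (insert \<alpha> S) \<beta> \<omega>)"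
proof (intro equalityI subsetI)
  fix p assume p: "p \<in> distinct_lists S \<alpha> \<omega>"
  then obtain q where q: "p = \<alpha> # q" by (cases p) (auto simp: distinct_lists_def)
  have "q \<noteq> []" using p q assms by (auto simp: distinct_lists_def)
  then have "hd q \<in> V - insert \<alpha> S" "q \<in> distinct_lists (insert \<alpha> S) (hd q) \<omega>"
    using p q by (auto simp: distinct_lists_def dest: hd_in_set)
  then show "p \<in> (\<Union>\<beta>\<in>V - insert \<alpha> S. (#) \<alpha> ` distinct_lists (insert \<alpha> S) \<beta> \<omega>)"
    using q by blast
qed (use assms in \<open>auto simp: distinct_lists_def\<close>)

text \<open>Induction on the number of vertices left. Block elimination deletes the start
  \<open>\<alpha>\<close>, and each block \<open>\<beta>\<close> of the remaining indices becomes
  the second vertex of a path, to which the induction hypothesis applies.\<close>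

theorem inv_on_path_expansion:
  assumes "S \<subseteq> V" "\<alpha> \<in> V - S" "\<omega> \<in> V - S" "i \<in> I \<omega>" "j \<in> I \<alpha>"
  shows "N S i j = (\<Sum>p\<in>distinct_lists S \<alpha> \<omega>. path_entry S p i j)"
  using assms
proof (induction "card (V - S)" arbitrary: S \<alpha> j rule: less_induct)
  case less
  show ?case
  proof (cases "\<alpha> = \<omega>")
    case True
    then show ?thesis using distinct_lists_same less.prems by simp
  next
    case False
    let ?S = "insert \<alpha> S"
    let ?D = "\<lambda>\<beta>. distinct_lists ?S \<beta> \<omega>"
    have S: "?S \<subseteq> V" "card (V - ?S) < card (V - S)"
      using less.prems by (blast, intro psubset_card_mono, auto)
    have i: "i \<in> rest S - I \<alpha>"
      using I_subset_rest[of ?S \<omega>] less.prems S(1) False by (auto simp: rest_insert)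
    have "N S i j = - (\<Sum>l\<in>rest ?S. \<Sum>k\<in>I \<alpha>. N ?S i l * J $$ (l, k) * N S k j)"
      unfolding rest_insert
      by (rule inv_on_block_elimination[OF info rest_subset I_subset_rest i])
        (use less.prems in auto)
    also have "\<dots> = - (\<Sum>\<beta>\<in>V - ?S. \<Sum>l\<in>I \<beta>. \<Sum>k\<in>I \<alpha>. N ?S i l * J $$ (l, k) * N S k j)"
      by (simp only: sum_rest[OF S(1)])
    also have "\<dots> = - (\<Sum>\<beta>\<in>V - ?S. \<Sum>l\<in>I \<beta>. \<Sum>k\<in>I \<alpha>.
        (\<Sum>p\<in>?D \<beta>. path_entry ?S p i l) * J $$ (l, k) * N S k j)"
      using less.hyps[OF S(2) S(1)] less.prems False
      by (intro arg_cong[of _ _ uminus] sum.cong refl) auto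
    also have "\<dots> = (\<Sum>\<beta>\<in>V - ?S. - (\<Sum>l\<in>I \<beta>. \<Sum>k\<in>I \<alpha>.
        (\<Sum>p\<in>?D \<beta>. path_entry ?S p i l) * J $$ (l, k) * N S k j))"
      by (simp only: sum_negf)
    also have "\<dots> = (\<Sum>\<beta>\<in>V - ?S. \<Sum>p\<in>?D \<beta>. path_entry S (\<alpha> # p) i j)"
    proof (rule sum.cong[OF refl])
      fix \<beta> assume "\<beta> \<in> V - ?S"
      have *: "path_entry S (\<alpha> # p) i j =
          - (\<Sum>l\<in>I \<beta>. \<Sum>k\<in>I \<alpha>. path_entry ?S p i l * J $$ (l, k) * N S k j)"
        if "p \<in> ?D \<beta>" for p
        using that by (cases p) (auto simp: distinct_lists_def)
      have "(\<Sum>l\<in>I \<beta>. \<Sum>k\<in>I \<alpha>. (\<Sum>p\<in>?D \<beta>. path_entry ?S p i l) * J $$ (l, k) * N S k j)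
        = (\<Sum>l\<in>I \<beta>. \<Sum>p\<in>?D \<beta>. \<Sum>k\<in>I \<alpha>. path_entry ?S p i l * J $$ (l, k) * N S k j)"
        unfolding sum_distrib_right by (intro sum.cong refl sum.swap)
      also have "\<dots> = (\<Sum>p\<in>?D \<beta>. \<Sum>l\<in>I \<beta>. \<Sum>k\<in>I \<alpha>. path_entry ?S p i l * J $$ (l, k) * N S k j)"
        by (rule sum.swap)
      also have "\<dots> = (\<Sum>p\<in>?D \<beta>. - path_entry S (\<alpha> # p) i j)"
        by (rule sum.cong) (simp_all add: *)
      finally show "- (\<Sum>l\<in>I \<beta>. \<Sum>k\<in>I \<alpha>. (\<Sum>p\<in>?D \<beta>. path_entry ?S p i l) * J $$ (l, k) * N S k j)
        = (\<Sum>p\<in>?D \<beta>. path_entry S (\<alpha> # p) i j)" by (simp add: sum_negf)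
    qed
    also have "\<dots> = (\<Sum>\<beta>\<in>V - ?S. \<Sum>p\<in>(#) \<alpha> ` ?D \<beta>. path_entry S p i j)"
      by (simp add: sum.reindex)
    \<comment> \<open>The union is disjoint since a list determines its second vertex.\<close>
    also have "\<dots> = (\<Sum>p\<in>distinct_lists S \<alpha> \<omega>. path_entry S p i j)"
      unfolding distinct_lists_rec[OF less.prems(2) False]
      by (rule sum.UNION_disjoint[symmetric])
        (simp_all add: finite_distinct_lists, auto simp: distinct_lists_def)
    finally show ?thesis .
  qed
qed

section \<open>From entries to ordered matrix products\<close>

text \<open>The walk factor with the blocks \<open>S\<close> deleted beforehand; splitting off the
  first vertex of a walk moves that vertex into \<open>S\<close>.\<close>

definition residual_factor :: "nat set \<Rightarrow> nat list \<Rightarrow> nat \<Rightarrow> real mat" where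
  "residual_factor S p j =
    diag_inv (S \<union> set (take j p)) (p ! j) * blk (p ! j) (p ! (j - 1))"

abbreviation walk_prod :: "nat set \<Rightarrow> nat list \<Rightarrow> real mat" where
  "walk_prod S p \<equiv> prod_right_to_left (card (I (hd p))) (residual_factor S p) (length p - 1)"

lemma residual_factor_carrier:
  "residual_factor S p j \<in> carrier_mat (card (I (p ! j))) (card (I (p ! (j - 1))))"
  unfolding residual_factor_def by (rule mult_carrier_mat[OF set_mat_carrier set_mat_carrier])

lemma walk_prod_carrier:
  assumes "p \<noteq> []"
  shows "walk_prod S p \<in> carrier_mat (card (I (last p))) (card (I (hd p)))"
  using prod_right_to_left_carrier[of "length p - 1" "residual_factor S p" "\<lambda>j. card (I (p ! j))"]
    assms residual_factor_carrier by (simp add: hd_conv_nth last_conv_nth)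

text \<open>Distinctness is asked only of the first \<open>j + 1\<close> entries, so that closed
  walks, whose last vertex repeats the first, are covered.\<close>

lemma walk_factor_eq:
  assumes "set p \<subseteq> V" "distinct (take (Suc j) p)" "j < length p"
  shows "walk_factor J I p j = residual_factor {} p j"
proof -
  have "p ! j \<in> V" "p ! (j - 1) \<in> V" "set (take j p) \<subseteq> V"
    using subsetD[OF assms(1) nth_mem] assms(3) subset_trans[OF set_take_subset assms(1)]
    by (simp_all only: less_imp_diff_less)
  moreover have "p ! j \<notin> set (take j p)"
    using assms by (simp add: take_Suc_conv_app_nth)
  ultimately show ?thesis
    unfolding walk_factor_def residual_factor_def by (simp add: deleted_inv_block_eq block_J)
qed

lemma walk_prod_Cons_Cons:
  "walk_prod S (\<alpha> # \<beta> # ps) =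
    walk_prod (insert \<alpha> S) (\<beta> # ps) * (diag_inv (insert \<alpha> S) \<beta> * blk \<beta> \<alpha>)"
proof -
  let ?p = "\<alpha> # \<beta> # ps"
  have "walk_prod S ?p = prod_right_to_left (card (I \<beta>)) (\<lambda>j. residual_factor S ?p (Suc j)) (length ps)
      * residual_factor S ?p 1"
    using prod_right_to_left_shift[of "length ps" "residual_factor S ?p" "\<lambda>j. card (I (?p ! j))",
        OF residual_factor_carrier] by simp
  \<comment> \<open>Shifting the index by one moves \<open>\<alpha>\<close> from the initial segment
    of the walk into the deleted set.\<close>
  also have "prod_right_to_left (card (I \<beta>)) (\<lambda>j. residual_factor S ?p (Suc j)) (length ps) =
      walk_prod (insert \<alpha> S) (\<beta> # ps)"
    by (auto simp: residual_factor_def nth_Cons' intro!: prod_right_to_left_cong)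
  also have "residual_factor S ?p 1 = diag_inv (insert \<alpha> S) \<beta> * blk \<beta> \<alpha>"
    by (simp add: residual_factor_def)
  finally show ?thesis .
qed

text \<open>Prepending \<open>\<alpha>\<close> costs one sign and one block of \<open>J\<close>;
  associativity attaches the new diagonal block to the product of the tail. Paths and cycles both
  use this step.\<close>

lemma signed_walk_prod_step:
  assumes "set_mat (I (last (\<beta> # ps))) (I \<beta>) (path_entry (insert \<alpha> S) (\<beta> # ps)) =
      (-1) ^ length ps \<cdot>\<^sub>m (walk_prod (insert \<alpha> S) (\<beta> # ps) * diag_inv (insert \<alpha> S) \<beta>)"
    (is "?T = _ \<cdot>\<^sub>m (?P * ?D)")
  shows "(-1) ^ Suc (length ps) \<cdot>\<^sub>m walk_prod S (\<alpha> # \<beta> # ps) = (-1) \<cdot>\<^sub>m (?T * blk \<beta> \<alpha>)"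
proof -
  have P: "?P \<in> carrier_mat (card (I (last (\<beta> # ps)))) (card (I \<beta>))"
    using walk_prod_carrier[of "\<beta> # ps"] by simp
  have PD: "?P * ?D \<in> carrier_mat (card (I (last (\<beta> # ps)))) (card (I \<beta>))"
    using P by (rule mult_carrier_mat) simp
  have "?P * (?D * blk \<beta> \<alpha>) = ?P * ?D * blk \<beta> \<alpha>"
    by (rule assoc_mult_mat[symmetric, OF P set_mat_carrier set_mat_carrier])
  then show ?thesis
    unfolding walk_prod_Cons_Cons assms
    using mult_smult_assoc_mat[OF PD, of "blk \<beta> \<alpha>" "card (I \<alpha>)" "(-1) ^ length ps"]
    by (auto intro!: eq_matI simp del: index_mult_mat(1))
qed

text \<open>The recursion of \<open>path_entry\<close> unrolled along the list: each step
  contributes a sign and a factor, and the diagonal block at the start vertex stays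
  rightmost.\<close>

lemma path_entry_mat:
  assumes "p \<noteq> []" "set p \<subseteq> V"
  shows "set_mat (I (last p)) (I (hd p)) (path_entry S p) =
    (-1) ^ (length p - 1) \<cdot>\<^sub>m (walk_prod S p * diag_inv S (hd p))"
  using assms
proof (induction p arbitrary: S rule: induct_list012)
  case (2 \<alpha>)
  have "path_entry S [\<alpha>] = N S" by (intro ext) simp
  then show ?case by (simp add: set_mat_smult)
next
  case (3 \<alpha> \<beta> ps)
  let ?T = "set_mat (I (last (\<beta> # ps))) (I \<beta>) (path_entry (insert \<alpha> S) (\<beta> # ps))"
  have fin: "finite (I \<alpha>)" "finite (I \<beta>)" using 3 finite_I by auto
  have T: "?T = (-1) ^ length ps \<cdot>\<^sub>m (walk_prod (insert \<alpha> S) (\<beta> # ps) * diag_inv (insert \<alpha> S) \<beta>)"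
    using 3 by simp
  have P: "walk_prod S (\<alpha> # \<beta> # ps) \<in> carrier_mat (card (I (last (\<beta> # ps)))) (card (I \<alpha>))"
    using walk_prod_carrier[of "\<alpha> # \<beta> # ps"] by simp
  have "(-1) ^ Suc (length ps) \<cdot>\<^sub>m (walk_prod S (\<alpha> # \<beta> # ps) * diag_inv S \<alpha>) =
      ((-1) ^ Suc (length ps) \<cdot>\<^sub>m walk_prod S (\<alpha> # \<beta> # ps)) * diag_inv S \<alpha>"
    by (rule mult_smult_assoc_mat[symmetric, OF P set_mat_carrier])
  also have "\<dots> = ((-1) \<cdot>\<^sub>m (?T * blk \<beta> \<alpha>)) * diag_inv S \<alpha>"
    by (simp only: signed_walk_prod_step[OF T])
  also have "\<dots> = set_mat (I (last (\<beta> # ps))) (I \<alpha>) (path_entry S (\<alpha> # \<beta> # ps))"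
    unfolding set_mat_mult[OF fin(1)] set_mat_mult[OF fin(2)] set_mat_smult
  proof (rule set_mat_cong)
    fix i j
    show "(\<Sum>k\<in>I \<alpha>. - 1 * (\<Sum>l\<in>I \<beta>. path_entry (insert \<alpha> S) (\<beta> # ps) i l * J $$ (l, k)) * N S k j)
        = path_entry S (\<alpha> # \<beta> # ps) i j"
      by (subst path_entry.simps, subst sum.swap) (simp add: sum_distrib_right sum_negf)
  qed
  finally show ?case by (simp del: path_entry.simps prod_right_to_left.simps)
qed simp

section \<open>Restriction to the edges of the block graph\<close>

abbreviation G :: "nat pair_pre_digraph" where "G \<equiv> block_graph B J I"

text \<open>The arc from \<open>\<alpha>\<close> to \<open>\<beta>\<close> stands for the block with
  rows \<open>I \<beta>\<close> and columns \<open>I \<alpha>\<close>, hence the order of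
  \<open>l\<close> and \<open>k\<close>.\<close>

lemma J_entry_zero:
  assumes "(\<alpha>, \<beta>) \<notin> parcs G" "\<alpha> \<in> V" "\<beta> \<in> V" "l \<in> I \<beta>" "k \<in> I \<alpha>"
  shows "J $$ (l, k) = 0"
proof (rule set_mat_eqD[OF _ finite_I finite_I])
  show "blk \<beta> \<alpha> = set_mat (I \<beta>) (I \<alpha>) (\<lambda>i j. 0)"
    using assms by (simp add: block_graph_def block_J set_mat_zero)
qed (use assms in auto)

text \<open>A missing arc makes a block of \<open>J\<close> in the recursion vanish, and every outer
  step passes the zero on.\<close>

lemma path_entry_zero:
  assumes "set p \<subseteq> V" "\<not> set (vwalk_arcs p) \<subseteq> parcs G" "j \<in> I (hd p)"
  shows "path_entry S p i j = 0"
  using assms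
proof (induction p arbitrary: S j rule: induct_list012)
  case (3 \<alpha> \<beta> ps)
  show ?case
  proof (cases "(\<alpha>, \<beta>) \<in> parcs G")
    case True
    then show ?thesis using 3 by simp
  next
    case False
    then show ?thesis using 3 J_entry_zero[OF False] by simp
  qed
qed auto

text \<open>Simple paths are the distinct lists that follow arcs, so their sum differs from the full
  path expansion only by vanishing terms.\<close>

lemma path_sum:
  assumes "\<alpha> \<in> V" "\<omega> \<in> V"
  shows "block (mat_inv J) I \<omega> \<alpha> =
    finsum_mat TYPE(real) (card (I \<omega>)) (card (I \<alpha>)) (path_term J I) (simple_paths G \<alpha> \<omega>)"
proof -
  have paths: "simple_paths G \<alpha> \<omega> =
      {p \<in> distinct_lists {} \<alpha> \<omega>. set (vwalk_arcs p) \<subseteq> parcs G}"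
    unfolding simple_paths_def distinct_lists_def vpath_def vwalk_def
    by (auto simp: block_graph_def)
  have fin: "finite (simple_paths G \<alpha> \<omega>)" by (simp add: paths finite_distinct_lists)
  have "path_term J I p = set_mat (I \<omega>) (I \<alpha>) (path_entry {} p)"
    if "p \<in> simple_paths G \<alpha> \<omega>" for p
  proof -
    have p: "p \<noteq> []" "distinct p" "set p \<subseteq> V" "hd p = \<alpha>" "last p = \<omega>"
      using that by (auto simp: paths distinct_lists_def)
    have "prod_right_to_left (card (I \<alpha>)) (walk_factor J I p) (length p - 1) = walk_prod {} p"
      unfolding p(4) by (rule prod_right_to_left_cong) (use p in \<open>auto intro!: walk_factor_eq\<close>)
    then show ?thesis
      using path_entry_mat[of p "{}"] p assms by (simp add: path_term_def block_mat_inv)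
  qed
  then have "finsum_mat TYPE(real) (card (I \<omega>)) (card (I \<alpha>)) (path_term J I) (simple_paths G \<alpha> \<omega>) =
      set_mat (I \<omega>) (I \<alpha>) (\<lambda>i j. \<Sum>p\<in>simple_paths G \<alpha> \<omega>. path_entry {} p i j)"
    by (rule finsum_mat_set_mat[OF fin])
  also have "\<dots> = set_mat (I \<omega>) (I \<alpha>) (N {})"
  proof (rule set_mat_cong)
    fix i j assume ij: "i \<in> I \<omega>" "j \<in> I \<alpha>"
    have "(\<Sum>p\<in>simple_paths G \<alpha> \<omega>. path_entry {} p i j) =
        (\<Sum>p\<in>distinct_lists {} \<alpha> \<omega>. path_entry {} p i j)"
    proof (rule sum.mono_neutral_left[OF finite_distinct_lists])
      show "\<forall>p\<in>distinct_lists {} \<alpha> \<omega> - simple_paths G \<alpha> \<omega>. path_entry {} p i j = 0"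
        using ij by (auto simp: paths distinct_lists_def intro!: path_entry_zero)
    qed (auto simp: paths)
    then show "(\<Sum>p\<in>simple_paths G \<alpha> \<omega>. path_entry {} p i j) = N {} i j"
      using inv_on_path_expansion[of "{}" \<alpha> \<omega> i j] assms ij by simp
  qed
  finally show ?thesis using block_mat_inv assms by simp
qed

section \<open>Simple cycles and the Schur complement\<close>

text \<open>The cycle \<open>\<alpha> # q @ [\<alpha>]\<close> is represented by its list \<open>q\<close> of intermediate vertices.\<close>

definition cycle_entry :: "nat \<Rightarrow> nat list \<Rightarrow> nat \<Rightarrow> nat \<Rightarrow> real" where
  "cycle_entry \<alpha> q i j = (if q = [] then J $$ (i, j)
    else - (\<Sum>k\<in>I (last q). \<Sum>l\<in>I (hd q). J $$ (i, k) * path_entry {\<alpha>} q k l * J $$ (l, j)))"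

text \<open>Removing \<open>\<alpha>\<close> from a cycle other than the self-loop leaves a path
  \<open>q\<close> in the graph without \<open>\<alpha>\<close>; blocks of \<open>J\<close> at both
  ends reattach it.\<close>

lemma cycle_term_eq:
  assumes \<alpha>: "\<alpha> \<in> V" and q: "distinct q" "set q \<subseteq> V - {\<alpha>}"
  shows "cycle_term J I (\<alpha> # q @ [\<alpha>]) = set_mat (I \<alpha>) (I \<alpha>) (cycle_entry \<alpha> q)"
proof (cases q)
  case Nil
  have "cycle_entry \<alpha> [] = (\<lambda>i j. J $$ (i, j))" by (intro ext) (simp add: cycle_entry_def)
  then show ?thesis using Nil \<alpha> by (simp add: cycle_term_def block_J set_mat_smult)
next
  case (Cons \<beta> ps)
  let ?c = "\<alpha> # q @ [\<alpha>]" and ?\<omega> = "last q"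
  let ?T = "set_mat (I ?\<omega>) (I \<beta>) (path_entry {\<alpha>} q)"
  have \<omega>: "?\<omega> \<in> V" using q Cons last_in_set[of q] by auto
  have \<beta>: "\<beta> \<in> V" using q Cons by auto
  have nth: "?c ! length q = ?\<omega>" using Cons by (simp add: nth_append last_conv_nth)
  have "prod_right_to_left (card (I \<alpha>)) (walk_factor J I ?c) (length q) =
      prod_right_to_left (card (I \<alpha>)) (residual_factor {} (\<alpha> # q)) (length q)"
  proof (rule prod_right_to_left_cong)
    fix j assume j: "1 \<le> j" "j \<le> length q"
    \<comment> \<open>As \<open>j\<close> is at most \<open>length q\<close>, the first
      \<open>j + 1\<close> entries stop before the repeated \<open>\<alpha>\<close>.\<close>
    have "walk_factor J I ?c j = residual_factor {} ?c j"
      by (rule walk_factor_eq) (use j q \<alpha> in \<open>auto dest: in_set_takeD\<close>)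
    also have "\<dots> = residual_factor {} (\<alpha> # q) j"
      using j by (cases j) (auto simp: residual_factor_def nth_append nth_Cons')
    finally show "walk_factor J I ?c j = residual_factor {} (\<alpha> # q) j" .
  qed
  then have prod: "prod_right_to_left (card (I \<alpha>)) (walk_factor J I ?c) (length q) =
      walk_prod {} (\<alpha> # q)" by simp
  have T: "?T = (-1) ^ length ps \<cdot>\<^sub>m (walk_prod {\<alpha>} (\<beta> # ps) * diag_inv {\<alpha>} \<beta>)"
    using path_entry_mat[of q "{\<alpha>}"] subset_trans[OF q(2) Diff_subset] Cons by simp
  \<comment> \<open>The exponent in \<open>cycle_term\<close> is \<open>length ps + 3\<close>, which
    has the parity of \<open>Suc (length ps)\<close>.\<close>
  have "cycle_term J I ?c = (-1) ^ Suc (length ps) \<cdot>\<^sub>m (blk \<alpha> ?\<omega> * walk_prod {} (\<alpha> # q))"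
    using prod nth \<alpha> \<omega> Cons by (simp add: cycle_term_def block_J)
  also have "\<dots> = blk \<alpha> ?\<omega> * ((-1) ^ Suc (length ps) \<cdot>\<^sub>m walk_prod {} (\<alpha> # q))"
    by (rule mult_smult_distrib[symmetric])
      (use walk_prod_carrier[of "\<alpha> # q" "{}"] Cons in auto)
  also have "\<dots> = blk \<alpha> ?\<omega> * ((-1) \<cdot>\<^sub>m (?T * blk \<beta> \<alpha>))"
    using signed_walk_prod_step[of \<beta> ps \<alpha> "{}"] T Cons by simp
  also have "\<dots> = set_mat (I \<alpha>) (I \<alpha>) (cycle_entry \<alpha> q)"
    unfolding set_mat_mult[OF finite_I[OF \<beta>]] set_mat_smult set_mat_mult[OF finite_I[OF \<omega>]]
    by (rule set_mat_cong)
      (simp add: cycle_entry_def Cons sum_distrib_left sum_negf mult.assoc)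
  finally show ?thesis .
qed

lemma set_vwalk_arcs_closed:
  "q \<noteq> [] \<Longrightarrow> set (vwalk_arcs (\<alpha> # q @ [\<beta>])) = {(\<alpha>, hd q), (last q, \<beta>)} \<union> set (vwalk_arcs q)"
  by (induction q arbitrary: \<alpha> rule: induct_list012) auto

text \<open>The missing arc leaves \<open>\<alpha>\<close>, enters \<open>\<alpha>\<close> or lies
  inside \<open>q\<close>; in each case one factor of every summand vanishes.\<close>

lemma cycle_entry_zero:
  assumes \<alpha>: "\<alpha> \<in> V" and q: "set q \<subseteq> V - {\<alpha>}"
    and ij: "i \<in> I \<alpha>" "j \<in> I \<alpha>" and "\<not> set (vwalk_arcs (\<alpha> # q @ [\<alpha>])) \<subseteq> parcs G"
  shows "cycle_entry \<alpha> q i j = 0"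
proof (cases "q = []")
  case True
  then show ?thesis using assms J_entry_zero[of \<alpha> \<alpha> i j] by (simp add: cycle_entry_def)
next
  case False
  then have V: "hd q \<in> V" "last q \<in> V" using q hd_in_set[of q] last_in_set[of q] by blast+
  have "J $$ (i, k) * path_entry {\<alpha>} q k l * J $$ (l, j) = 0"
    if kl: "k \<in> I (last q)" "l \<in> I (hd q)" for k l
  proof -
    consider "(\<alpha>, hd q) \<notin> parcs G" | "(last q, \<alpha>) \<notin> parcs G" | "\<not> set (vwalk_arcs q) \<subseteq> parcs G"
      using assms(5) unfolding set_vwalk_arcs_closed[OF False] by auto
    then show ?thesis
      using J_entry_zero[of \<alpha> "hd q" l j] J_entry_zero[of "last q" \<alpha> i k]
        path_entry_zero[of q l "{\<alpha>}" k] kl V \<alpha> ij q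
      by cases auto
  qed
  then show ?thesis by (simp add: cycle_entry_def False sum.neutral del: mult_eq_0_iff)
qed

text \<open>Grouped by last and first vertex, the nonempty lists form the path expansions of the
  blocks of \<open>N {\<alpha>}\<close>; the empty list, the self-loop, gives
  \<open>J $$ (i, j)\<close>. The total is an entry of the Schur complement.\<close>

lemma cycle_entry_sum:
  assumes \<alpha>: "\<alpha> \<in> V"
  shows "(\<Sum>q | distinct q \<and> set q \<subseteq> V - {\<alpha>}. cycle_entry \<alpha> q i j) =
    J $$ (i, j) - (\<Sum>k\<in>rest {\<alpha>}. \<Sum>l\<in>rest {\<alpha>}. J $$ (i, k) * N {\<alpha>} k l * J $$ (l, j))"
proof -
  let ?Q = "{q. distinct q \<and> set q \<subseteq> V - {\<alpha>}}" and ?V = "V - {\<alpha>}"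
  let ?f = "\<lambda>q k l. J $$ (i, k) * path_entry {\<alpha>} q k l * J $$ (l, j)"
  let ?D = "\<lambda>\<omega> \<beta>. distinct_lists {\<alpha>} \<beta> \<omega>"
  have fib: "{q \<in> ?Q - {[]}. (last q, hd q) = (\<omega>, \<beta>)} = ?D \<omega> \<beta>" for \<omega> \<beta>
    by (auto simp: distinct_lists_def)
  have "(\<Sum>q\<in>?Q - {[]}. cycle_entry \<alpha> q i j) =
      (\<Sum>x\<in>?V \<times> ?V. \<Sum>q\<in>{q \<in> ?Q - {[]}. (last q, hd q) = x}. cycle_entry \<alpha> q i j)"
  proof (rule sum.group[symmetric])
    show "(\<lambda>q. (last q, hd q)) ` (?Q - {[]}) \<subseteq> ?V \<times> ?V"
      using hd_in_set last_in_set by fast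
  qed (use finite_distinct_subset[of "{\<alpha>}"] in auto)
  also have "\<dots> = (\<Sum>(\<omega>, \<beta>)\<in>?V \<times> ?V. \<Sum>q\<in>?D \<omega> \<beta>. cycle_entry \<alpha> q i j)"
    by (intro sum.cong refl) (auto simp only: fib split: prod.split)
  also have "\<dots> = (\<Sum>\<omega>\<in>?V. \<Sum>\<beta>\<in>?V. \<Sum>q\<in>?D \<omega> \<beta>. cycle_entry \<alpha> q i j)"
    by (rule sum.cartesian_product[symmetric])
  also have "\<dots> = (\<Sum>\<omega>\<in>?V. \<Sum>\<beta>\<in>?V. - (\<Sum>k\<in>I \<omega>. \<Sum>l\<in>I \<beta>. J $$ (i, k) * N {\<alpha>} k l * J $$ (l, j)))"
  proof (intro sum.cong refl)
    fix \<omega> \<beta> assume \<omega>\<beta>: "\<omega> \<in> ?V" "\<beta> \<in> ?V"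
    have "(\<Sum>q\<in>?D \<omega> \<beta>. cycle_entry \<alpha> q i j) = (\<Sum>q\<in>?D \<omega> \<beta>. - (\<Sum>k\<in>I \<omega>. \<Sum>l\<in>I \<beta>. ?f q k l))"
      by (rule sum.cong) (auto simp: cycle_entry_def distinct_lists_def)
    also have "\<dots> = - (\<Sum>k\<in>I \<omega>. \<Sum>l\<in>I \<beta>. \<Sum>q\<in>?D \<omega> \<beta>. ?f q k l)"
      unfolding sum_negf by (subst sum.swap, subst (2) sum.swap) (rule refl)
    also have "\<dots> = - (\<Sum>k\<in>I \<omega>. \<Sum>l\<in>I \<beta>. J $$ (i, k) * N {\<alpha>} k l * J $$ (l, j))"
      using inv_on_path_expansion[of "{\<alpha>}" \<beta> \<omega>] \<alpha> \<omega>\<beta>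
      by (intro arg_cong[of _ _ uminus] sum.cong refl) (simp add: sum_distrib_left sum_distrib_right)
    finally show "(\<Sum>q\<in>?D \<omega> \<beta>. cycle_entry \<alpha> q i j) =
      - (\<Sum>k\<in>I \<omega>. \<Sum>l\<in>I \<beta>. J $$ (i, k) * N {\<alpha>} k l * J $$ (l, j))" .
  qed
  also have "\<dots> = - (\<Sum>\<omega>\<in>?V. \<Sum>k\<in>I \<omega>. \<Sum>\<beta>\<in>?V. \<Sum>l\<in>I \<beta>. J $$ (i, k) * N {\<alpha>} k l * J $$ (l, j))"
    unfolding sum_negf by (subst (2) sum.swap) (rule refl)
  also have "\<dots> = - (\<Sum>k\<in>rest {\<alpha>}. \<Sum>l\<in>rest {\<alpha>}. J $$ (i, k) * N {\<alpha>} k l * J $$ (l, j))"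
    using \<alpha> by (simp add: sum_rest)
  finally show ?thesis
    using finite_distinct_subset[of "{\<alpha>}"] by (subst sum.remove[of _ "[]"]) (auto simp: cycle_entry_def)
qed

text \<open>Length at least one makes the two occurrences of \<open>\<alpha>\<close> different
  positions, so both can be stripped.\<close>

lemma simple_cycles_eq:
  assumes "\<alpha> \<in> V"
  shows "simple_cycles G \<alpha> = (\<lambda>q. \<alpha> # q @ [\<alpha>]) `
    {q. distinct q \<and> set q \<subseteq> V - {\<alpha>} \<and> set (vwalk_arcs (\<alpha> # q @ [\<alpha>])) \<subseteq> parcs G}"
    (is "_ = ?f ` ?Q")
proof (intro equalityI subsetI)
  fix c assume c: "c \<in> simple_cycles G \<alpha>"
  then have len: "length c \<ge> 2" by (auto simp: simple_cycles_def)
  then obtain d where d: "c = \<alpha> # d" "d \<noteq> []" using c by (cases c; cases "tl c") (auto simp: simple_cycles_def)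
  then have "c = ?f (butlast d)" using c append_butlast_last_id[of d] by (auto simp: simple_cycles_def)
  then show "c \<in> ?f ` ?Q"
    using c by (intro image_eqI[of _ _ "butlast d"])
      (auto simp: simple_cycles_def vwalk_def block_graph_def butlast_append)
next
  fix c assume "c \<in> ?f ` ?Q"
  then show "c \<in> simple_cycles G \<alpha>"
    using assms by (auto simp: simple_cycles_def vwalk_def block_graph_def butlast_append)
qed

lemma cycle_sum:
  assumes \<alpha>: "\<alpha> \<in> V"
  shows "finsum_mat TYPE(real) (card (I \<alpha>)) (card (I \<alpha>)) (cycle_term J I) (simple_cycles G \<alpha>) =
    set_mat (I \<alpha>) (I \<alpha>) (\<lambda>i j. J $$ (i, j) -
      (\<Sum>k\<in>rest {\<alpha>}. \<Sum>l\<in>rest {\<alpha>}. J $$ (i, k) * N {\<alpha>} k l * J $$ (l, j)))"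
proof -
  let ?Q = "{q. distinct q \<and> set q \<subseteq> V - {\<alpha>}}" and ?f = "\<lambda>q. \<alpha> # q @ [\<alpha>]"
  let ?W = "{q. distinct q \<and> set q \<subseteq> V - {\<alpha>} \<and> set (vwalk_arcs (?f q)) \<subseteq> parcs G}"
  have fin: "finite ?W" by (rule finite_subset[OF _ finite_distinct_subset[of "{\<alpha>}"]]) auto
  have inj: "inj_on ?f ?W" by (auto simp: inj_on_def)
  \<comment> \<open>The intermediate list is recovered from the cycle \<open>c\<close> as
    \<open>butlast (tl c)\<close>.\<close>
  have "finsum_mat TYPE(real) (card (I \<alpha>)) (card (I \<alpha>)) (cycle_term J I) (?f ` ?W) =
      set_mat (I \<alpha>) (I \<alpha>) (\<lambda>i j. \<Sum>c\<in>?f ` ?W. cycle_entry \<alpha> (butlast (tl c)) i j)"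
    by (rule finsum_mat_set_mat) (use fin cycle_term_eq[OF \<alpha>] in auto)
  also have "\<dots> = set_mat (I \<alpha>) (I \<alpha>) (\<lambda>i j. \<Sum>q\<in>?W. cycle_entry \<alpha> q i j)"
    unfolding sum.reindex[OF inj] by simp
  also have "\<dots> = set_mat (I \<alpha>) (I \<alpha>) (\<lambda>i j. \<Sum>q\<in>?Q. cycle_entry \<alpha> q i j)"
    by (intro set_mat_cong sum.mono_neutral_left)
      (use finite_distinct_subset[of "{\<alpha>}"] cycle_entry_zero[OF \<alpha>] in auto)
  finally show ?thesis by (simp only: simple_cycles_eq[OF \<alpha>] cycle_entry_sum[OF \<alpha>])
qed

text \<open>Block elimination turns the subtracted part of the Schur complement, multiplied by the
  diagonal block of the inverse, into the missing summands of the rows \<open>I \<alpha>\<close> of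
  \<open>J * N {} = 1\<close>.\<close>

lemma cycle_sum_mult:
  assumes \<alpha>: "\<alpha> \<in> V"
  shows "finsum_mat TYPE(real) (card (I \<alpha>)) (card (I \<alpha>)) (cycle_term J I) (simple_cycles G \<alpha>)
    * block (mat_inv J) I \<alpha> \<alpha> = 1\<^sub>m (card (I \<alpha>))"
proof -
  let ?R = "rest {\<alpha>}" and ?N = "N {}" and ?N' = "N {\<alpha>}"
  have R: "?R = rest {} - I \<alpha>" by (rule rest_insert)
  have I: "I \<alpha> \<subseteq> rest {}" using I_subset_rest[of "{}" \<alpha>] \<alpha> by simp
  have "(\<Sum>m\<in>I \<alpha>. (J $$ (i, m) - (\<Sum>k\<in>?R. \<Sum>l\<in>?R. J $$ (i, k) * ?N' k l * J $$ (l, m))) * ?N m j)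
      = of_bool (i = j)" if ij: "i \<in> I \<alpha>" "j \<in> I \<alpha>" for i j
  proof -
    have "(\<Sum>m\<in>I \<alpha>. (\<Sum>k\<in>?R. \<Sum>l\<in>?R. J $$ (i, k) * ?N' k l * J $$ (l, m)) * ?N m j)
        = (\<Sum>k\<in>?R. J $$ (i, k) * (\<Sum>l\<in>?R. \<Sum>m\<in>I \<alpha>. ?N' k l * J $$ (l, m) * ?N m j))"
      unfolding sum_distrib_left sum_distrib_right
      by (subst sum.swap, subst (2) sum.swap) (simp add: mult.assoc)
    also have "\<dots> = (\<Sum>k\<in>?R. J $$ (i, k) * - ?N k j)"
    proof (intro sum.cong refl)
      fix k assume "k \<in> ?R"
      then show "J $$ (i, k) * (\<Sum>l\<in>?R. \<Sum>m\<in>I \<alpha>. ?N' k l * J $$ (l, m) * ?N m j) =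
          J $$ (i, k) * - ?N k j"
        using inv_on_block_elimination[OF info rest_subset I, of k j] ij unfolding R by simp
    qed
    finally have "(\<Sum>m\<in>I \<alpha>. (J $$ (i, m)
          - (\<Sum>k\<in>?R. \<Sum>l\<in>?R. J $$ (i, k) * ?N' k l * J $$ (l, m))) * ?N m j)
        = (\<Sum>m\<in>I \<alpha>. J $$ (i, m) * ?N m j) + (\<Sum>k\<in>?R. J $$ (i, k) * ?N k j)"
      by (simp add: left_diff_distrib sum_subtractf sum_negf)
    \<comment> \<open>The indices in \<open>I \<alpha>\<close> and those in \<open>?R\<close>
      together are all indices.\<close>
    also have "\<dots> = (\<Sum>k\<in>rest {}. J $$ (i, k) * ?N k j)"
      unfolding R by (subst sum.subset_diff[OF I finite_rest]) (rule add.commute)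
    also have "\<dots> = of_bool (i = j)"
      using inv_on_inverse(1)[OF info rest_subset] I ij by blast
    finally show ?thesis .
  qed
  then show ?thesis
    unfolding cycle_sum[OF \<alpha>] block_mat_inv[OF \<alpha> \<alpha>] set_mat_mult[OF finite_I[OF \<alpha>]]
      set_mat_one[symmetric]
    by (intro set_mat_cong)
qed

end

text \<open>Invertibility of \<open>C\<close> is asserted separately because \<open>mat_inv\<close>
  is unspecified on singular matrices.\<close>

theorem mainTheorem2:
  fixes J :: "real mat" and n B :: nat and I :: "nat \<Rightarrow> nat set" and \<alpha> \<omega> :: nat
  defines "G \<equiv> block_graph B J I"
  defines "C \<equiv> finsum_mat TYPE(real) (card (I \<alpha>)) (card (I \<alpha>)) (cycle_term J I) (simple_cycles G \<alpha>)"
  assumes "information_matrix n J"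
    and "1 \<le> B" and "B \<le> n"
    and "index_partition n B I"
    and "\<alpha> \<in> {1..B}" and "\<omega> \<in> {1..B}"
  shows "block (mat_inv J) I \<omega> \<alpha> =
           finsum_mat TYPE(real) (card (I \<omega>)) (card (I \<alpha>)) (path_term J I) (simple_paths G \<alpha> \<omega>)
         \<and> invertible_mat C
         \<and> block (mat_inv J) I \<alpha> \<alpha> = mat_inv C"
proof -
  interpret P: partitioned_information_matrix J n B I
    using assms by unfold_locales
  have C: "C \<in> carrier_mat (card (I \<alpha>)) (card (I \<alpha>))"
    unfolding C_def G_def P.cycle_sum[OF assms(7)] by simp
  have X: "block (mat_inv J) I \<alpha> \<alpha> \<in> carrier_mat (card (I \<alpha>)) (card (I \<alpha>))"
    unfolding P.block_mat_inv[OF assms(7) assms(7)] by simp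
  \<comment> \<open>This right inverse yields both the invertibility of \<open>C\<close> and the
    value of \<open>mat_inv C\<close>.\<close>
  have CX: "C * block (mat_inv J) I \<alpha> \<alpha> = 1\<^sub>m (card (I \<alpha>))"
    unfolding C_def G_def by (rule P.cycle_sum_mult[OF assms(7)])
  show ?thesis
    using P.path_sum[OF assms(7,8)] mat_inv_eq[OF C X CX] by (simp add: G_def)
qed

end
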